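(* Let $S$ be a shearing subgroup (in dimension $d$) with Lie algebra $\mathfrak{s}$, and let $X_2,\ldots,X_d$ be the canonical basis of $\mathfrak{s}$. Then: (a) $S=\{I_d+X:X\in\mathfrak{s}\}$. (b) For every $h\in S$, writing $h=(h_{i,j})_{1\le i,j\le d}$ (an upper triangular matrix with ones on the diagonal), one has $h=I_d+\sum_{i=2}^d h_{1,i}X_i$.
   Context: Shearing subgroups. For a closed subgroup $H<\mathrm{GL}(d,\mathbb{R})$ let $G=\mathbb{R}^d\rtimes H$ with product $(x,h)(y,g)=(x+hy,hg)$ and quasi-regular representation $[\pi(x,h)f](y)=|\det h|^{-1/2}f(h^{-1}(y-x))$ on $L^2(\mathbb{R}^d)$. $H$ is irreducibly admissible if $\pi$ is an irreducible square-integrable representation; equivalently, the dual action $(\xi,h)\mapsto h^T\xi$ has a single open orbit, of full measure, with compact stabilizers. Let $T(d,\mathbb{R})$ be the group of upper triangular real $d\times d$ matrices with ones on the diagonal. An irreducibly admissible $H$ is a generalized shearlet dilation group if there are closed subgroups $S,D<H$ such that: (i) $S$ is a connected abelian Lie subgroup of $T(d,\mathbb{R})$; (ii) $D=\{\exp(rY):r\in\mathbb{R}\}$ with $Y$ a diagonal matrix; (iii) every $h\in H$ can be written uniquely as $h=\pm ds$ with $d\in D$, $s\in S$. A group $S$ is a shearing subgroup if it occurs in this way for some generalized shearlet dilation group. Canonical basis. The Lie algebra $\mathfrak{s}$ of a shearing subgroup has a unique basis $X_2,\ldots,X_d$ with $X_i^Te_1=e_i$ for $i=2,\ldots,d$ ($e_1,\ldots,e_d$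 the canonical basis of $\mathbb{R}^d$); this is called the canonical basis of $\mathfrak{s}$. *)

theory Defs
  imports "HOL-Analysis.Analysis" "HOL-Algebra.Group"
begin

text \<open>
  The dimension is \<open>d = CARD('n)\<close>. The finite linear order on the index type plays the role of
  the order of \<open>1, \<dots>, d\<close>, so that triangularity makes sense and \<open>idx1\<close> is the index \<open>1\<close>.
\<close>

type_synonym 'n sqmat = "((real, 'n) vec, 'n) vec"

definition idx1 :: "'n::{finite,linorder}" where
  "idx1 = Min UNIV"

definition GL :: "'n::finite sqmat monoid" where
  "GL = \<lparr>carrier = {A. invertible A}, mult = (**), one = mat 1\<rparr>"

definition closed_subgroup_GL :: "'n::finite sqmat set \<Rightarrow> bool" where
  "closed_subgroup_GL H \<longleftrightarrow>
     subgroup H GL \<and> closedin (top_of_set (carrier GL)) H"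

definition unipotent_upper :: "'n::{finite,linorder} sqmat set" where
  "unipotent_upper = {A. (\<forall>i. A $ i $ i = 1) \<and> (\<forall>i j. j < i \<longrightarrow> A $ i $ j = 0)}"

text \<open>The type class exponential \<open>exp\<close> does not apply, since matrices with the product \<open>(**)\<close>
  are not an instance of a normed algebra.\<close>

definition matrix_exp :: "'n::finite sqmat \<Rightarrow> 'n sqmat" where
  "matrix_exp A = (\<Sum>k. (1 / fact k) *\<^sub>R (((**) A ^^ k) (mat 1)))"

definition lie_algebra :: "'n::finite sqmat set \<Rightarrow> 'n sqmat set" where
  "lie_algebra S = {X. \<forall>t::real. matrix_exp (t *\<^sub>R X) \<in> S}"


section \<open>The quasi-regular representation\<close>

definition semidirect :: "'n sqmat set \<Rightarrow> ((real^'n) \<times> 'n sqmat) monoid" where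
  "semidirect H =
     \<lparr>carrier = UNIV \<times> H,
      mult = (\<lambda>(x, h) (y, g). (x + h *v y, h ** g)),
      one = (0, mat 1)\<rparr>"

text \<open>Elements of \<open>L\<^sup>2(\<real>\<^sup>d)\<close> are represented by Borel measurable functions; functions that agree
  almost everywhere represent the same element.\<close>

definition L2 :: "(real^'n \<Rightarrow> complex) set" where
  "L2 = {f \<in> borel_measurable lborel. integrable lborel (\<lambda>y. (cmod (f y))\<^sup>2)}"

definition L2_inner :: "(real^'n \<Rightarrow> complex) \<Rightarrow> (real^'n \<Rightarrow> complex) \<Rightarrow> complex" where
  "L2_inner f g = (LINT y|lborel. f y * cnj (g y))"

definition L2_zero :: "(real^'n \<Rightarrow> complex) set" where
  "L2_zero = {f \<in> L2. AE y in lborel. f y = 0}"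

text \<open>Applying the closure condition to constant sequences shows that a closed subspace is
  saturated under equality almost everywhere.\<close>

definition L2_closed_subspace :: "(real^'n \<Rightarrow> complex) set \<Rightarrow> bool" where
  "L2_closed_subspace V \<longleftrightarrow>
     V \<subseteq> L2 \<and> (\<lambda>y. 0) \<in> V \<and>
     (\<forall>f\<in>V. \<forall>g\<in>V. (\<lambda>y. f y + g y) \<in> V) \<and>
     (\<forall>c. \<forall>f\<in>V. (\<lambda>y. c * f y) \<in> V) \<and>
     (\<forall>F. \<forall>f\<in>L2. (\<forall>k::nat. F k \<in> V) \<and>
        (\<lambda>k. LINT y|lborel. (cmod (F k y - f y))\<^sup>2) \<longlonglongrightarrow> 0 \<longrightarrow> f \<in> V)"

definition quasi_regular ::
    "(real^'n) \<times> 'n sqmat \<Rightarrow> (real^'n \<Rightarrow> complex) \<Rightarrow> (real^'n \<Rightarrow> complex)" where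
  "quasi_regular = (\<lambda>(x, h) f y.
     of_real (\<bar>det h\<bar> powr (-1/2)) * f (matrix_inv h *v (y - x)))"

definition irreducible_on_L2 ::
    "'g monoid \<Rightarrow> ('g \<Rightarrow> (real^'n \<Rightarrow> complex) \<Rightarrow> (real^'n \<Rightarrow> complex)) \<Rightarrow> bool" where
  "irreducible_on_L2 G \<pi> \<longleftrightarrow>
     (\<forall>V. L2_closed_subspace V \<and> (\<forall>g\<in>carrier G. \<forall>f\<in>V. \<pi> g f \<in> V)
        \<longrightarrow> V = L2_zero \<or> V = L2)"

text \<open>Below, the carrier of \<open>G\<close> is a locally compact, second countable subspace of a Euclidean
  space, so a Borel measure that is finite on compact sets is automatically a Radon measure.\<close>

definition left_haar_measure :: "('g::topological_space) monoid \<Rightarrow> 'g measure \<Rightarrow> bool" where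
  "left_haar_measure G \<mu> \<longleftrightarrow>
     space \<mu> = carrier G \<and>
     sets \<mu> = sets (restrict_space borel (carrier G)) \<and>
     emeasure \<mu> (carrier G) \<noteq> 0 \<and>
     (\<forall>K. compact K \<and> K \<subseteq> carrier G \<longrightarrow> emeasure \<mu> K < \<infinity>) \<and>
     (\<forall>g\<in>carrier G. \<forall>A\<in>sets \<mu>. emeasure \<mu> ((\<lambda>z. g \<otimes>\<^bsub>G\<^esub> z) ` A) = emeasure \<mu> A)"

definition square_integrable_on_L2 ::
    "('g::topological_space) monoid \<Rightarrow> ('g \<Rightarrow> (real^'n \<Rightarrow> complex) \<Rightarrow> (real^'n \<Rightarrow> complex)) \<Rightarrow> bool"
  where
  "square_integrable_on_L2 G \<pi> \<longleftrightarrow>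
     (\<exists>\<mu>. left_haar_measure G \<mu> \<and>
        (\<exists>\<psi> \<in> L2 - L2_zero.
           (\<integral>\<^sup>+ z. ennreal ((cmod (L2_inner \<psi> (\<pi> z \<psi>)))\<^sup>2) \<partial>\<mu>) < \<infinity>))"

definition irreducibly_admissible :: "'n::finite sqmat set \<Rightarrow> bool" where
  "irreducibly_admissible H \<longleftrightarrow>
     closed_subgroup_GL H \<and>
     irreducible_on_L2 (semidirect H) (quasi_regular :: _ \<Rightarrow> (real^'n \<Rightarrow> complex) \<Rightarrow> _) \<and>
     square_integrable_on_L2 (semidirect H) (quasi_regular :: _ \<Rightarrow> (real^'n \<Rightarrow> complex) \<Rightarrow> _)"


section \<open>Generalized shearlet dilation groups\<close>

definition closed_subgroup_of :: "'n::finite sqmat set \<Rightarrow> 'n sqmat set \<Rightarrow> bool" where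
  "closed_subgroup_of K H \<longleftrightarrow>
     subgroup K (GL\<lparr>carrier := H\<rparr>) \<and> closedin (top_of_set H) K"

text \<open>A closed subgroup of \<open>GL\<close> is a Lie subgroup by Cartan's theorem, so the Lie property of
  \<open>S\<close> is contained in its closedness.\<close>

definition shearlet_decomposition ::
    "'n::{finite,linorder} sqmat set \<Rightarrow> 'n sqmat set \<Rightarrow> 'n sqmat set \<Rightarrow> bool" where
  "shearlet_decomposition H S D \<longleftrightarrow>
     closed_subgroup_of S H \<and> closed_subgroup_of D H \<and>
     S \<subseteq> unipotent_upper \<and> connected S \<and> comm_group (GL\<lparr>carrier := S\<rparr>) \<and>
     (\<exists>Y. (\<forall>i j. i \<noteq> j \<longrightarrow> Y $ i $ j = 0) \<and> D = range (\<lambda>r::real. matrix_exp (r *\<^sub>R Y))) \<and>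
     (\<forall>h\<in>H. \<exists>!(\<epsilon>, d, s). (\<epsilon>, d, s) \<in> {1, -1 :: real} \<times> D \<times> S \<and> h = \<epsilon> *\<^sub>R (d ** s))"

definition generalized_shearlet_dilation_group ::
    "'n::{finite,linorder} sqmat set \<Rightarrow> bool" where
  "generalized_shearlet_dilation_group H \<longleftrightarrow>
     irreducibly_admissible H \<and> (\<exists>S D. shearlet_decomposition H S D)"

definition shearing_subgroup :: "'n::{finite,linorder} sqmat set \<Rightarrow> bool" where
  "shearing_subgroup S \<longleftrightarrow>
     (\<exists>H D. generalized_shearlet_dilation_group H \<and> shearlet_decomposition H S D)"

text \<open>Only the values of \<open>X\<close> at the indices different from \<open>idx1\<close> matter. The last condition
  determines them uniquely when \<open>\<ss>\<close> is the Lie algebra of a shearing subgroup.\<close>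

definition canonical_basis ::
    "'n::{finite,linorder} sqmat set \<Rightarrow> ('n \<Rightarrow> 'n sqmat) \<Rightarrow> bool" where
  "canonical_basis \<ss> X \<longleftrightarrow>
     inj_on X (- {idx1}) \<and> independent (X ` (- {idx1})) \<and> span (X ` (- {idx1})) = \<ss> \<and>
     (\<forall>i. i \<noteq> idx1 \<longrightarrow> transpose (X i) *v axis idx1 1 = axis i 1)"

end

theory Submission
  imports Defs
begin

text \<open>
  The first row is a linear coordinate system on the centralizer of \<open>\<ss>\<close>: since \<open>X\<^sub>i\<close> has first row
  \<open>e\<^sub>i\<close>, the \<open>i\<close>-th row of a matrix \<open>M\<close> is the first row of \<open>X\<^sub>i M\<close>, and if \<open>M\<close> commutes with \<open>X\<^sub>i\<close>
  this is the first row of \<open>M X\<^sub>i\<close>, which depends only on the first row of \<open>M\<close>. So a matrix that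
  commutes with all \<open>X\<^sub>i\<close> equals \<open>M\<^sub>1\<^sub>1 I + \<Sum> M\<^sub>1\<^sub>i X\<^sub>i\<close>, because the latter has the
  same first row and, when the \<open>X\<^sub>i\<close> commute, lies in the centralizer as well (\<open>centralizer_expansion\<close>).

  Differentiating \<open>h exp(tZ) = exp(tZ) h\<close> at \<open>t = 0\<close> shows that an element of the abelian group \<open>S\<close>
  commutes with \<open>\<ss>\<close>, and a second differentiation shows that \<open>\<ss>\<close> is abelian
  (\<open>commutes_lie_algebra\<close>). So the expansion applies to \<open>S\<close>, which proves (b) and the inclusion of
  \<open>S\<close> in \<open>I + \<ss>\<close>. It also identifies \<open>\<ss>\<close> with the strictly upper triangular part of the
  centralizer, so that \<open>\<ss>\<close> is closed under multiplication, although it was given only as a Lie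
  algebra.

  For the other inclusion, \<open>I + W\<close> with \<open>W \<in> \<ss>\<close> is compared with \<open>E = exp W \<in> S\<close>. In
  \<open>I + W = E (I + E\<^sup>-\<^sup>1 (I + W - E))\<close> the new element \<open>E\<^sup>-\<^sup>1 (I + W - E)\<close> lies again in \<open>\<ss>\<close>, but
  starts at least one superdiagonal further away from the diagonal than \<open>W\<close>, because \<open>I + W - E\<close> is
  a combination of the powers \<open>W\<^sup>k\<close> with \<open>k \<ge> 2\<close>. Iterating, the correction becomes \<open>0\<close>. This
  factorization of \<open>I + W\<close> into exponentials takes the place of its logarithm.
\<close>

section \<open>The matrix exponential entry by entry\<close>

abbreviation matrix_power :: "'n::finite sqmat \<Rightarrow> nat \<Rightarrow> 'n sqmat" where
  "matrix_power A k \<equiv> ((**) A ^^ k) (mat 1)"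

lemma bounded_bilinear_matrix_mult:
  "bounded_bilinear ((**) :: 'n::finite sqmat \<Rightarrow> 'n sqmat \<Rightarrow> 'n sqmat)"
  unfolding bilinear_conv_bounded_bilinear[symmetric]
  by (auto simp: bilinear_def linear_iff vec_eq_iff matrix_matrix_mult_def sum.distrib
      sum_distrib_left algebra_simps)

lemmas matrix_mult_distribs =
  bounded_bilinear.add_left[OF bounded_bilinear_matrix_mult]
  bounded_bilinear.add_right[OF bounded_bilinear_matrix_mult]
  bounded_bilinear.diff_left[OF bounded_bilinear_matrix_mult]
  bounded_bilinear.diff_right[OF bounded_bilinear_matrix_mult]
  bounded_bilinear.scaleR_left[OF bounded_bilinear_matrix_mult]
  bounded_bilinear.scaleR_right[OF bounded_bilinear_matrix_mult]
  bounded_bilinear.sum_left[OF bounded_bilinear_matrix_mult]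
  bounded_bilinear.sum_right[OF bounded_bilinear_matrix_mult]

lemma matrix_power_scaleR: "matrix_power (t *\<^sub>R A) k = t ^ k *\<^sub>R matrix_power A k"
  by (induction k) (simp_all add: matrix_mult_distribs mult.commute)

text \<open>The geometric growth of the entries makes the exponential series converge.\<close>

lemma matrix_power_entry_bound:
  fixes A :: "'n::finite sqmat"
  shows "\<bar>matrix_power A k $ i $ j\<bar> \<le> (\<Sum>p\<in>UNIV. \<Sum>q\<in>UNIV. \<bar>A $ p $ q\<bar>) ^ k"
proof (induction k arbitrary: i j)
  case 0
  show ?case by (simp add: mat_def)
next
  case (Suc k)
  let ?C = "\<Sum>p\<in>UNIV. \<Sum>q\<in>UNIV. \<bar>A $ p $ q\<bar>"
  have "\<bar>matrix_power A (Suc k) $ i $ j\<bar> = \<bar>\<Sum>l\<in>UNIV. A $ i $ l * matrix_power A k $ l $ j\<bar>"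
    by (simp add: matrix_matrix_mult_def)
  also have "\<dots> \<le> (\<Sum>l\<in>UNIV. \<bar>A $ i $ l\<bar> * ?C ^ k)"
    by (rule order_trans[OF sum_abs]) (auto simp: abs_mult intro!: sum_mono mult_left_mono Suc.IH)
  also have "\<dots> = (\<Sum>l\<in>UNIV. \<bar>A $ i $ l\<bar>) * ?C ^ k"
    by (simp add: sum_distrib_right)
  also have "\<dots> \<le> ?C * ?C ^ k"
    by (intro mult_right_mono member_le_sum zero_le_power sum_nonneg) auto
  finally show ?case by simp
qed

lemma summable_matrix_exp_entry:
  "summable (\<lambda>k. matrix_power A k $ i $ j / fact k * t ^ k)"
proof (rule summable_comparison_test')
  let ?C = "\<Sum>p\<in>UNIV. \<Sum>q\<in>UNIV. \<bar>A $ p $ q\<bar>"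
  show "summable (\<lambda>k. (?C * \<bar>t\<bar>) ^ k / fact k)"
    using summable_exp_generic[of "?C * \<bar>t\<bar>"] by (simp add: field_simps)
  show "norm (matrix_power A k $ i $ j / fact k * t ^ k) \<le> (?C * \<bar>t\<bar>) ^ k / fact k" if "0 \<le> k" for k
    using mult_right_mono[OF matrix_power_entry_bound[of k A i j], of "\<bar>t\<bar> ^ k"]
    by (simp add: abs_mult power_abs power_mult_distrib divide_right_mono)
qed

lemma matrix_exp_entry:
  "matrix_exp (t *\<^sub>R A) $ i $ j = (\<Sum>k. matrix_power A k $ i $ j / fact k * t ^ k)"
proof -
  define E where "E = (\<chi> i j. \<Sum>k. matrix_power A k $ i $ j / fact k * t ^ k)"
  have "(\<lambda>k. (1 / fact k) *\<^sub>R matrix_power (t *\<^sub>R A) k) sums E"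
    unfolding sums_def
  proof (intro vec_tendstoI)
    fix i j
    show "(\<lambda>n. (\<Sum>k<n. (1 / fact k) *\<^sub>R matrix_power (t *\<^sub>R A) k) $ i $ j) \<longlonglongrightarrow> E $ i $ j"
      using summable_sums[OF summable_matrix_exp_entry[of A i j t]]
      by (simp add: sums_def E_def matrix_power_scaleR mult.commute)
  qed
  then have "matrix_exp (t *\<^sub>R A) = E"
    unfolding matrix_exp_def by (simp add: sums_iff)
  then show ?thesis by (simp add: E_def)
qed

lemma matrix_exp_has_derivative_at_0:
  "((\<lambda>t. matrix_exp (t *\<^sub>R A) $ i $ j) has_real_derivative A $ i $ j) (at 0)"
proof -
  have "((\<lambda>t. \<Sum>k. matrix_power A k $ i $ j / fact k * t ^ k) has_real_derivative
      (\<Sum>k. diffs (\<lambda>k. matrix_power A k $ i $ j / fact k) k * 0 ^ k)) (at 0)"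
    by (rule termdiffs_strong_converges_everywhere) (rule summable_matrix_exp_entry)
  then show ?thesis
    unfolding matrix_exp_entry powser_zero by (simp add: diffs_def)
qed

section \<open>Differentiating inside an abelian unipotent group\<close>

text \<open>The matrix \<open>h\<close> need not belong to \<open>S\<close>: the lemma gives first that \<open>S\<close> commutes with its Lie
  algebra, and then, with \<open>h\<close> in the Lie algebra, that the Lie algebra is abelian.\<close>

lemma commutes_lie_algebra:
  assumes comm: "\<And>g. g \<in> S \<Longrightarrow> h ** g = g ** h" and Z: "Z \<in> lie_algebra S"
  shows "h ** Z = Z ** h"
proof -
  have "(h ** Z) $ i $ j = (Z ** h) $ i $ j" for i j
  proof -
    have "((\<lambda>t. (h ** matrix_exp (t *\<^sub>R Z)) $ i $ j) has_real_derivative (h ** Z) $ i $ j) (at 0)"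
      by (auto simp: matrix_matrix_mult_def
            intro!: DERIV_sum DERIV_cmult matrix_exp_has_derivative_at_0)
    moreover
    have "((\<lambda>t. (matrix_exp (t *\<^sub>R Z) ** h) $ i $ j) has_real_derivative (Z ** h) $ i $ j) (at 0)"
      by (auto simp: matrix_matrix_mult_def
            intro!: DERIV_sum DERIV_cmult_right matrix_exp_has_derivative_at_0)
    moreover have "h ** matrix_exp (t *\<^sub>R Z) = matrix_exp (t *\<^sub>R Z) ** h" for t
      using comm Z by (auto simp: lie_algebra_def)
    ultimately show ?thesis
      by (metis (no_types, lifting) DERIV_unique ext)
  qed
  then show ?thesis by (simp add: vec_eq_iff)
qed

text \<open>On and below the diagonal the entries of the curve \<open>exp(tZ)\<close> are constant.\<close>

lemma lie_algebra_strictly_upper: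
  assumes "S \<subseteq> unipotent_upper" "Z \<in> lie_algebra S" "j \<le> i"
  shows "Z $ i $ j = 0"
proof -
  have "matrix_exp (t *\<^sub>R Z) $ i $ j = (if i = j then 1 else 0)" for t
    using assms by (auto simp: lie_algebra_def unipotent_upper_def subset_iff less_le)
  then show ?thesis
    using DERIV_unique[OF matrix_exp_has_derivative_at_0[of Z i j]] by simp
qed

section \<open>The filtration by superdiagonals\<close>

text \<open>Counting the predecessors of an index turns the distance of an entry from the diagonal into a
  number.\<close>

definition index_rank :: "'n::{finite,linorder} \<Rightarrow> nat" where
  "index_rank i = card {..<i}"

lemma index_rank_less_iff: "index_rank i < index_rank j \<longleftrightarrow> i < j"
proof -
  have "index_rank i < index_rank j" if "i < j" for i j :: 'a
    using that unfolding index_rank_def by (intro psubset_card_mono) auto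
  then show ?thesis by (metis less_asym linorder_neqE)
qed

lemma index_rank_le_iff: "index_rank i \<le> index_rank j \<longleftrightarrow> i \<le> j"
  using index_rank_less_iff[of j i] by (simp add: linorder_not_less[symmetric])

lemma index_rank_less_card: "index_rank (i::'n::{finite,linorder}) < CARD('n)"
  unfolding index_rank_def by (intro psubset_card_mono) auto

definition zero_below_superdiagonal :: "nat \<Rightarrow> 'n::{finite,linorder} sqmat \<Rightarrow> bool" where
  "zero_below_superdiagonal k M \<longleftrightarrow>
     (\<forall>i j. index_rank j < index_rank i + k \<longrightarrow> M $ i $ j = 0)"

lemma zero_below_superdiagonal_mono:
  "zero_below_superdiagonal k M \<Longrightarrow> l \<le> k \<Longrightarrow> zero_below_superdiagonal l M"
  by (auto simp: zero_below_superdiagonal_def)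

lemma unipotent_upper_zero_below:
  "M \<in> unipotent_upper \<Longrightarrow> zero_below_superdiagonal 0 M"
  by (simp add: zero_below_superdiagonal_def unipotent_upper_def index_rank_less_iff)

lemma strictly_upper_zero_below:
  "(\<And>i j. j \<le> i \<Longrightarrow> M $ i $ j = 0) \<Longrightarrow> zero_below_superdiagonal 1 M"
  by (simp add: zero_below_superdiagonal_def less_Suc_eq_le index_rank_le_iff)

text \<open>A path from \<open>i\<close> to \<open>j\<close> through \<open>l\<close> that is shorter than \<open>a + b\<close> has a first step shorter than \<open>a\<close>
  or a second step shorter than \<open>b\<close>.\<close>

lemma zero_below_superdiagonal_mult:
  assumes M: "zero_below_superdiagonal a M" and N: "zero_below_superdiagonal b N"
  shows "zero_below_superdiagonal (a + b) (M ** N)"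
  unfolding zero_below_superdiagonal_def
proof (intro allI impI)
  fix i j :: 'a
  assume short: "index_rank j < index_rank i + (a + b)"
  have "M $ i $ l * N $ l $ j = 0" for l
  proof (cases "index_rank l < index_rank i + a")
    case True
    then show ?thesis using M by (simp add: zero_below_superdiagonal_def)
  next
    case False
    then show ?thesis using N short by (simp add: zero_below_superdiagonal_def)
  qed
  then show "(M ** N) $ i $ j = 0"
    unfolding matrix_matrix_mult_def by (simp add: sum.neutral del: mult_eq_0_iff)
qed

lemma zero_below_superdiagonal_power:
  assumes "zero_below_superdiagonal k M"
  shows "zero_below_superdiagonal (m * k) (matrix_power M m)"
proof (induction m)
  case 0
  show ?case by (auto simp: zero_below_superdiagonal_def mat_def)
next
  case (Suc m)
  then show ?case using zero_below_superdiagonal_mult[OF assms] by simp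
qed

lemma zero_below_superdiagonal_imp_zero:
  fixes M :: "'n::{finite,linorder} sqmat"
  assumes "zero_below_superdiagonal CARD('n) M"
  shows "M = 0"
  using assms
  by (simp add: zero_below_superdiagonal_def vec_eq_iff trans_less_add2[OF index_rank_less_card])

text \<open>The terms of the exponential series after the linear one are multiples of \<open>W\<^sup>m\<close> with \<open>m \<ge> 2\<close>.\<close>

lemma zero_below_superdiagonal_exp_remainder:
  assumes W: "zero_below_superdiagonal k W"
  shows "zero_below_superdiagonal (2 * k) (mat 1 + W - matrix_exp W)"
  unfolding zero_below_superdiagonal_def
proof (intro allI impI)
  fix i j :: 'a
  assume short: "index_rank j < index_rank i + 2 * k"
  have "matrix_power W m $ i $ j = 0" if "2 \<le> m" for m
  proof -
    have "2 * k \<le> m * k" using that by simp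
    with short have "index_rank j < index_rank i + m * k" by linarith
    then show ?thesis
      using zero_below_superdiagonal_power[OF W, of m] by (simp add: zero_below_superdiagonal_def)
  qed
  then have "(\<Sum>m. matrix_power W m $ i $ j / fact m * 1 ^ m) =
      (\<Sum>m<2. matrix_power W m $ i $ j / fact m * 1 ^ m)"
    by (intro suminf_finite) auto
  then have "matrix_exp W $ i $ j = mat 1 $ i $ j + W $ i $ j"
    using matrix_exp_entry[of 1 W i j] by (simp add: numeral_2_eq_2)
  then show "(mat 1 + W - matrix_exp W) $ i $ j = 0" by simp
qed

section \<open>The centralizer of the canonical basis\<close>

lemma row_mult: "(A ** B) $ i = A $ i v* B"
  by (simp add: vec_eq_iff matrix_matrix_mult_def vector_matrix_mult_def mult.commute)

text \<open>The \<open>p\<close>-th unit row vector is cyclic for the matrices \<open>X i\<close>: together with its images under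
  them it spans the row space, and a matrix that commutes with the \<open>X i\<close> is determined by its
  value on a cyclic vector.\<close>

lemma centralizer_determined_by_row:
  fixes X :: "'n::finite \<Rightarrow> 'n sqmat"
  assumes row: "\<And>i. i \<noteq> p \<Longrightarrow> X i $ p = axis i 1"
    and M: "\<And>i. i \<noteq> p \<Longrightarrow> M ** X i = X i ** M"
    and N: "\<And>i. i \<noteq> p \<Longrightarrow> N ** X i = X i ** N"
    and eq: "M $ p = N $ p"
  shows "M = N"
proof -
  have "M $ i = N $ i" if "i \<noteq> p" for i
  proof -
    have from_row: "A $ i = A $ p v* X i" if "A ** X i = X i ** A" for A
    proof -
      have "A $ i = axis i 1 v* A"
        by (simp add: vec_eq_iff vector_matrix_mult_def axis_def if_distrib if_distribR cong: if_cong)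
      also have "\<dots> = (X i ** A) $ p"
        using row[OF \<open>i \<noteq> p\<close>] by (simp add: row_mult)
      also have "\<dots> = A $ p v* X i"
        by (simp add: that[symmetric] row_mult)
      finally show ?thesis .
    qed
    show ?thesis using from_row[OF M] from_row[OF N] that eq by simp
  qed
  with eq show ?thesis by (metis vec_eq_iff)
qed

text \<open>The right-hand side lies in the centralizer too, as the \<open>X i\<close> commute, and its coefficients are
  chosen to give it the same \<open>p\<close>-th row as \<open>M\<close>.\<close>

lemma centralizer_expansion:
  fixes X :: "'n::finite \<Rightarrow> 'n sqmat"
  assumes row: "\<And>i. i \<noteq> p \<Longrightarrow> X i $ p = axis i 1"
    and X: "\<And>i j. i \<noteq> p \<Longrightarrow> j \<noteq> p \<Longrightarrow> X i ** X j = X j ** X i"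
    and M: "\<And>i. i \<noteq> p \<Longrightarrow> M ** X i = X i ** M"
  shows "M = M $ p $ p *\<^sub>R mat 1 + (\<Sum>i\<in>-{p}. M $ p $ i *\<^sub>R X i)"
    (is "M = ?N")
proof (rule centralizer_determined_by_row[where X = X and p = p])
  show "?N ** X i = X i ** ?N" if "i \<noteq> p" for i
    using that X by (simp add: matrix_mult_distribs)
  show "M $ p = ?N $ p"
  proof (simp add: vec_eq_iff, intro allI)
    fix j
    have "(\<Sum>i\<in>-{p}. M $ p $ i * X i $ p $ j) = (\<Sum>i\<in>-{p}. if i = j then M $ p $ i else 0)"
      by (rule sum.cong) (auto simp: row axis_def)
    also have "\<dots> = (if j = p then 0 else M $ p $ j)"
      by simp
    finally show "M $ p $ j = M $ p $ p * mat 1 $ p $ j + (\<Sum>i\<in>-{p}. M $ p $ i * X i $ p $ j)"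
      by (auto simp: mat_def)
  qed
qed (use row M in auto)

section \<open>Shearing subgroups\<close>

theorem lemma6:
  fixes S :: "'n::{finite,linorder} sqmat set"
    and X :: "'n \<Rightarrow> 'n sqmat"
  assumes "shearing_subgroup S"
    and "canonical_basis (lie_algebra S) X"
  shows "S = {mat 1 + Z |Z. Z \<in> lie_algebra S} \<and>
    (\<forall>h\<in>S. h = mat 1 + (\<Sum>i\<in>- {idx1}. h $ idx1 $ i *\<^sub>R X i))"
proof -
  have unip: "S \<subseteq> unipotent_upper" and "comm_group (GL\<lparr>carrier := S\<rparr>)"
    using assms(1) by (auto simp: shearing_subgroup_def shearlet_decomposition_def)
  then interpret S: comm_group "GL\<lparr>carrier := S\<rparr>" by simp
  have one_S: "mat 1 \<in> S"
    and mult_S: "\<And>g h. g \<in> S \<Longrightarrow> h \<in> S \<Longrightarrow> g ** h \<in> S"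
    and comm_S: "\<And>g h. g \<in> S \<Longrightarrow> h \<in> S \<Longrightarrow> g ** h = h ** g"
    using S.one_closed S.m_closed S.m_comm by (simp_all add: GL_def)
  have inv_S: "\<exists>g'\<in>S. g ** g' = mat 1" if "g \<in> S" for g
    using S.r_inv_ex[of g] that by (simp add: GL_def)

  have span_X: "span (X ` (- {idx1})) = lie_algebra S"
    using assms(2) by (simp add: canonical_basis_def)
  have X_in: "X i \<in> lie_algebra S" if "i \<noteq> idx1" for i
    using that unfolding span_X[symmetric] by (intro span_base) simp
  have row: "X i $ idx1 = axis i 1" if "i \<noteq> idx1" for i
  proof -
    have "transpose (X i) *v axis idx1 1 = X i $ idx1"
      by (simp add: matrix_vector_mult_basis row_def column_def transpose_def vec_eq_iff)
    with that show ?thesis using assms(2) by (simp add: canonical_basis_def)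
  qed

  have comm_S_lie: "h ** Z = Z ** h" if "h \<in> S" "Z \<in> lie_algebra S" for h Z
    by (rule commutes_lie_algebra[OF comm_S[OF that(1)] that(2)])
  have comm_lie: "Z ** W = W ** Z" if "Z \<in> lie_algebra S" "W \<in> lie_algebra S" for Z W
    by (rule commutes_lie_algebra[OF comm_S_lie[OF _ that(1), symmetric] that(2)])
  have expansion: "M = M $ idx1 $ idx1 *\<^sub>R mat 1 + (\<Sum>i\<in>-{idx1}. M $ idx1 $ i *\<^sub>R X i)"
    if "\<And>i. i \<noteq> idx1 \<Longrightarrow> M ** X i = X i ** M" for M
    by (rule centralizer_expansion) (use row comm_lie X_in that in auto)
  have sum_in: "(\<Sum>i\<in>-{idx1}. c i *\<^sub>R X i) \<in> lie_algebra S" for c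
    unfolding span_X[symmetric] by (intro span_sum span_scale span_base) simp

  have part_b: "h = mat 1 + (\<Sum>i\<in>-{idx1}. h $ idx1 $ i *\<^sub>R X i)" if "h \<in> S" for h
  proof -
    have "h $ idx1 $ idx1 = 1" using that unip by (auto simp: unipotent_upper_def)
    then show ?thesis using expansion[of h] comm_S_lie[OF that] X_in by simp
  qed

  \<comment> \<open>Downward induction on the first superdiagonal where \<open>W\<close> may be nonzero.\<close>
  have add_one_in_S: "mat 1 + W \<in> S"
    if "k \<le> CARD('n)" "1 \<le> k" "W \<in> lie_algebra S" "zero_below_superdiagonal k W" for k W
    using that
  proof (induction k arbitrary: W rule: inc_induct)
    case base
    then have "W = 0" using zero_below_superdiagonal_imp_zero by blast
    then show ?case using one_S by simp
  next
    case (step k)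
    define E where "E = matrix_exp W"
    have "matrix_exp (1 *\<^sub>R W) \<in> S"
      using step.prems(2) unfolding lie_algebra_def by blast
    then have E: "E \<in> S" by (simp add: E_def)
    then obtain E' where E': "E' \<in> S" "E ** E' = mat 1" using inv_S by blast
    \<comment> \<open>the solution of \<open>E ** (mat 1 + W') = mat 1 + W\<close>\<close>
    define W' where "W' = E' ** (mat 1 + W - E)"
    have "zero_below_superdiagonal (0 + 2 * k) W'"
      using unip E'(1) step.prems(3) unfolding W'_def E_def
      by (intro zero_below_superdiagonal_mult unipotent_upper_zero_below
          zero_below_superdiagonal_exp_remainder) auto
    \<comment> \<open>\<open>k \<ge> 1\<close> makes \<open>2 * k\<close> larger than \<open>k\<close>.\<close>
    then have zero: "zero_below_superdiagonal (Suc k) W'"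
      by (rule zero_below_superdiagonal_mono) (use step.prems(1) in simp)
    \<comment> \<open>\<open>W'\<close> is a product of elements of the centralizer, so it can be expanded in the basis; its
      strict triangularity removes the identity component.\<close>
    have "W' ** X i = X i ** W'" if "i \<noteq> idx1" for i
    proof -
      have "(mat 1 + W - E) ** X i = X i ** (mat 1 + W - E)"
        using comm_lie[OF step.prems(2) X_in[OF that]] comm_S_lie[OF E X_in[OF that]]
        by (simp add: matrix_mult_distribs)
      then show ?thesis
        using comm_S_lie[OF E'(1) X_in[OF that]]
        by (simp add: W'_def matrix_mul_assoc[symmetric]) (simp add: matrix_mul_assoc)
    qed
    from expansion[OF this]
    have "W' = W' $ idx1 $ idx1 *\<^sub>R mat 1 + (\<Sum>i\<in>-{idx1}. W' $ idx1 $ i *\<^sub>R X i)" .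
    moreover have "W' $ idx1 $ idx1 = 0"
      using zero by (simp add: zero_below_superdiagonal_def)
    ultimately have "W' \<in> lie_algebra S"
      using sum_in[of "\<lambda>i. W' $ idx1 $ i"] by simp
    then have "mat 1 + W' \<in> S" using step.IH zero by simp
    then have "E ** (mat 1 + W') \<in> S" using E mult_S by blast
    also have "E ** (mat 1 + W') = mat 1 + W"
      by (simp add: W'_def matrix_mult_distribs(2) matrix_mul_assoc E'(2))
    finally show ?case .
  qed

  have "S = {mat 1 + Z |Z. Z \<in> lie_algebra S}"
  proof (intro equalityI subsetI)
    fix h assume "h \<in> S"
    then show "h \<in> {mat 1 + Z |Z. Z \<in> lie_algebra S}"
      using part_b sum_in[of "\<lambda>i. h $ idx1 $ i"] by blast
  next
    fix h assume "h \<in> {mat 1 + Z |Z. Z \<in> lie_algebra S}"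
    then obtain Z where Z: "Z \<in> lie_algebra S" "h = mat 1 + Z" by blast
    have "zero_below_superdiagonal 1 Z"
      by (intro strictly_upper_zero_below lie_algebra_strictly_upper[OF unip Z(1)])
    then show "h \<in> S"
      using add_one_in_S[of 1 Z] Z by (simp add: Suc_le_eq)
  qed
  with part_b show ?thesis by blast
qed

end
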